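(* Let $d\ge 1$ and let $\mathbf{s}=(s_1,\ldots,s_d)$ be a strictly increasing sequence of positive integers such that $\mathbf{P}_d^{(\mathbf{s})}$ is translation equivalent to a Fano polytope. Set $s_0=1$ and $k_i=s_{i+1}-s_i$ for $0\le i\le d-1$. Then $\mathbf{P}_d^{(\mathbf{s})}$ is reflexive up to translation (that is, translation equivalent to a reflexive polytope) if and only if for each $0\le i\le d-1$ one has $k_i\mid s_i$ and $k_i\mid s_{i+1}$.
   Context: For a sequence of positive integers $\mathbf{s}=(s_1,\ldots,s_d)$, the $\mathbf{s}$-lecture hall polytope is $\mathbf{P}_d^{(\mathbf{s})}=\{\mathbf{x}\in\mathbb{R}^d : 0\le \frac{x_1}{s_1}\le\frac{x_2}{s_2}\le\cdots\le\frac{x_d}{s_d}\le 1\}$, a $d$-dimensional lattice polytope. A $d$-dimensional lattice polytope $\mathcal{P}\subset\mathbb{R}^d$ is Fano if $(\mathcal{P}\setminus\partial\mathcal{P})\cap\mathbb{Z}^d=\{\mathbf{0}\}$. It is reflexive if it is Fano and its dual polytope $\mathcal{P}^\vee=\{y\in\mathbb{R}^d : \langle x,y\rangle\le 1 \text{ for all } x\in\mathcal{P}\}$ is a lattice polytope. Two lattice polytopes are translation equivalent if one is the translate of the other by a vector in $\mathbb{Z}^d$. *)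

theory Defs
  imports "HOL-Analysis.Analysis"
begin

definition int_lattice :: "(real ^ 'n::finite) set" where
  "int_lattice = {x. \<forall>i. x $ i \<in> \<int>}"

definition lattice_polytope :: "(real ^ 'n::finite) set \<Rightarrow> bool" where
  "lattice_polytope P \<longleftrightarrow> (\<exists>V. finite V \<and> V \<subseteq> int_lattice \<and> P = convex hull V)"

text \<open>The coordinates of \<open>real ^ 'n\<close> carry no order of their own. A bijection \<open>e\<close> from
  \<open>{1..d}\<close> onto \<open>'n\<close> numbers them, so that \<open>x $ e i\<close> is the \<open>i\<close>-th coordinate of \<open>x\<close>.
  Only the values of \<open>s\<close> on \<open>{1..d}\<close> matter.\<close>

definition lecture_hall_polytope ::
    "nat \<Rightarrow> (nat \<Rightarrow> 'n) \<Rightarrow> (nat \<Rightarrow> int) \<Rightarrow> (real ^ 'n::finite) set" where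
  "lecture_hall_polytope d e s =
     {x. 0 \<le> x $ e 1 / of_int (s 1) \<and>
         (\<forall>i\<in>{1..<d}. x $ e i / of_int (s i) \<le> x $ e (i + 1) / of_int (s (i + 1))) \<and>
         x $ e d / of_int (s d) \<le> 1}"

definition fano_polytope :: "(real ^ 'n::finite) set \<Rightarrow> bool" where
  "fano_polytope P \<longleftrightarrow>
     lattice_polytope P \<and> aff_dim P = int CARD('n) \<and> (P - frontier P) \<inter> int_lattice = {0}"

definition dual_polytope :: "(real ^ 'n::finite) set \<Rightarrow> (real ^ 'n) set" where
  "dual_polytope P = {y. \<forall>x\<in>P. x \<bullet> y \<le> 1}"

definition reflexive_polytope :: "(real ^ 'n::finite) set \<Rightarrow> bool" where
  "reflexive_polytope P \<longleftrightarrow> fano_polytope P \<and> lattice_polytope (dual_polytope P)"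

definition translation_equivalent :: "(real ^ 'n::finite) set \<Rightarrow> (real ^ 'n) set \<Rightarrow> bool" where
  "translation_equivalent P Q \<longleftrightarrow> (\<exists>v\<in>int_lattice. Q = (\<lambda>x. v + x) ` P)"

end

theory Submission
  imports Defs
begin

text \<open>The integer point \<open>(s\<^sub>1 - 1, \<dots>, s\<^sub>d - 1)\<close> lies in the interior of the lecture hall
  simplex as soon as \<open>s\<^sub>1 \<ge> 2\<close>, and lowering its first coordinate to \<open>1\<close> gives another interior
  point; so the Fano condition forces \<open>s\<^sub>1 = 2\<close> and determines the translation. After this
  translation the facets are \<open>n\<^sub>j \<bullet> y \<le> 1\<close>, where the \<open>j\<close>-th facet for \<open>1 \<le> j < d\<close> has
  \<open>n\<^sub>j = (s\<^sub>j\<^sub>+\<^sub>1 e\<^sub>j - s\<^sub>j e\<^sub>j\<^sub>+\<^sub>1) / k\<^sub>j\<close>, while \<open>n\<^sub>0 = - e\<^sub>1\<close> and \<open>n\<^sub>d = e\<^sub>d\<close>. The dual polytope is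
  the convex hull of the \<open>n\<^sub>j\<close>, all of which are vertices of it, and it is a lattice polytope
  precisely if every \<open>n\<^sub>j\<close> is integral.\<close>

section \<open>Polar duality for finitely many halfspaces\<close>

text \<open>A point outside the hull is strictly separated from it; since 0 lies in the hull, the
  functional rescales to a point of the polyhedron that excludes the given point from the
  dual.\<close>

lemma dual_polytope_halfspaces:
  fixes N :: "(real ^ 'n::finite) set"
  assumes "finite N" "0 \<in> convex hull N"
  shows "dual_polytope {y. \<forall>a\<in>N. a \<bullet> y \<le> 1} = convex hull N"
proof
  show "convex hull N \<subseteq> dual_polytope {y. \<forall>a\<in>N. a \<bullet> y \<le> 1}"
  proof (rule hull_minimal)
    show "N \<subseteq> dual_polytope {y. \<forall>a\<in>N. a \<bullet> y \<le> 1}"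
      by (auto simp: dual_polytope_def inner_commute)
    have "dual_polytope S = (\<Inter>x\<in>S. {y. x \<bullet> y \<le> 1})" for S :: "(real ^ 'n) set"
      by (auto simp: dual_polytope_def)
    then show "convex (dual_polytope {y. \<forall>a\<in>N. a \<bullet> y \<le> 1})"
      by (simp add: convex_INT convex_halfspace_le)
  qed
next
  show "dual_polytope {y. \<forall>a\<in>N. a \<bullet> y \<le> 1} \<subseteq> convex hull N"
  proof (rule subsetI, rule ccontr)
    fix z assume z: "z \<in> dual_polytope {y. \<forall>a\<in>N. a \<bullet> y \<le> 1}" and "z \<notin> convex hull N"
    moreover have "closed (convex hull N)"
      using assms(1) by (simp add: compact_imp_closed finite_imp_compact_convex_hull)
    ultimately obtain a b where ab: "a \<bullet> z < b" "\<And>x. x \<in> convex hull N \<Longrightarrow> b < a \<bullet> x"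
      using separating_hyperplane_closed_point[of "convex hull N" z] by auto
    have b: "b < 0" using ab(2)[OF assms(2)] by simp
    \<comment> \<open>Dividing by the negative \<open>b\<close> reverses both inequalities of
      \<open>ab\<close>: the product is below 1 on the hull and above 1 at \<open>z\<close>.\<close>
    have "x \<bullet> (a /\<^sub>R b) \<le> 1" if "x \<in> N" for x
      using ab(2)[OF hull_inc[OF that]] b by (simp add: inner_commute field_simps)
    then have "(a /\<^sub>R b) \<bullet> z \<le> 1"
      using z by (simp add: dual_polytope_def del: inner_scaleR_left inner_scaleR_right)
    then show False using ab(1) b by (simp add: field_simps)
  qed
qed

lemma minus_frontier: "S - frontier S = interior S"
  using closure_subset[of S] interior_subset[of S] by (auto simp: frontier_def)

section \<open>Numbered coordinates and interior lattice points\<close>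

locale lecture_hall =
  fixes d :: nat and e :: "nat \<Rightarrow> 'n::finite" and s :: "nat \<Rightarrow> int"
  assumes d_pos: "d \<ge> 1"
    and bij_e: "bij_betw e {1..d} (UNIV :: 'n set)"
    and s_pos: "i \<in> {1..d} \<Longrightarrow> s i > 0"
    and s_strict_mono: "strict_mono_on {1..d} s"
begin

abbreviation P :: "(real ^ 'n) set" where
  "P \<equiv> lecture_hall_polytope d e s"

definition of_coords :: "(nat \<Rightarrow> real) \<Rightarrow> real ^ 'n" where
  "of_coords f = (\<chi> m. f (inv_into {1..d} e m))"

lemma of_coords_nth [simp]: "i \<in> {1..d} \<Longrightarrow> of_coords f $ e i = f i"
  using bij_e by (simp add: of_coords_def bij_betw_def inv_into_f_f)

lemma e_surj: obtains i where "i \<in> {1..d}" "m = e i"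
  using bij_e by (metis UNIV_I bij_betw_imp_surj_on imageE)

lemma e_eq_iff: "i \<in> {1..d} \<Longrightarrow> j \<in> {1..d} \<Longrightarrow> e i = e j \<longleftrightarrow> i = j"
  using bij_e by (meson bij_betw_def inj_on_eq_iff)

lemma s_less: "i \<in> {1..<d} \<Longrightarrow> s i < s (Suc i)"
  using s_strict_mono by (rule strict_mono_onD) auto

lemma s_first_le: "i \<in> {1..d} \<Longrightarrow> s 1 \<le> s i"
  using strict_mono_on_leD[OF s_strict_mono, of 1 i] by auto

text \<open>The strict versions of the defining inequalities cut out an open subset of
  \<open>P\<close>.\<close>

lemma of_coords_in_interior:
  assumes "0 < f 1"
    and "\<And>i. i \<in> {1..<d} \<Longrightarrow> f i / of_int (s i) < f (Suc i) / of_int (s (Suc i))"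
    and "f d < of_int (s d)"
  shows "of_coords f \<in> interior P"
proof (rule interiorI)
  let ?U = "{x :: real ^ 'n. 0 < x $ e 1} \<inter>
    (\<Inter>i\<in>{1..<d}. {x. x $ e i / of_int (s i) < x $ e (Suc i) / of_int (s (Suc i))}) \<inter>
    {x. x $ e d < of_int (s d)}"
  have "s i \<noteq> 0" if "Suc 0 \<le> i" "i \<le> d" for i
    using s_pos[of i] that by auto
  then show "open ?U"
    by (intro open_Int open_INT ballI finite_atLeastLessThan open_Collect_less continuous_intros
        continuous_on_component) auto
  show "of_coords f \<in> ?U" using assms d_pos by auto
  show "?U \<subseteq> P" using d_pos s_pos[of 1] s_pos[of d]
    by (auto simp: lecture_hall_polytope_def less_imp_le)
qed

lemma lecture_hall_first_le:
  assumes "x \<in> P"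
  shows "0 \<le> x $ e 1" "x $ e 1 \<le> of_int (s 1)"
proof -
  have "x $ e 1 / of_int (s 1) \<le> x $ e i / of_int (s i)" if "1 \<le> i" "i \<le> d" for i
    using that
  proof (induction i rule: dec_induct)
    case (step i)
    then show ?case using assms by (force simp: lecture_hall_polytope_def)
  qed simp
  from this[of d] have "x $ e 1 / of_int (s 1) \<le> 1"
    using d_pos assms by (auto simp: lecture_hall_polytope_def)
  then show "x $ e 1 \<le> of_int (s 1)" using s_pos[of 1] d_pos by (simp add: field_simps)
  show "0 \<le> x $ e 1" using assms s_pos[of 1] d_pos
    by (auto simp: lecture_hall_polytope_def zero_le_divide_iff)
qed

text \<open>The interior of \<open>P\<close> lies in the interiors of the two halfspaces bounding
  the first coordinate, and these are strict halfspaces.\<close>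

lemma interior_first_less:
  assumes "x \<in> interior P"
  shows "0 < x $ e 1" "x $ e 1 < of_int (s 1)"
proof -
  have "x \<in> interior {x. axis (e 1) 1 \<bullet> x \<ge> 0}" "x \<in> interior {x. axis (e 1) 1 \<bullet> x \<le> of_int (s 1)}"
    using interior_mono assms lecture_hall_first_le
    by (smt (verit) cart_eq_inner_axis inner_commute mem_Collect_eq subset_eq)+
  then show "0 < x $ e 1" "x $ e 1 < of_int (s 1)"
    by (simp_all add: interior_halfspace_le interior_halfspace_ge inner_axis' axis_eq_0_iff)
qed

lemma of_coords_int_lattice:
  assumes "\<And>i. i \<in> {1..d} \<Longrightarrow> f i \<in> \<int>"
  shows "of_coords f \<in> int_lattice"
proof -
  have "of_coords f $ m \<in> \<int>" for m
  proof -
    obtain i where "i \<in> {1..d}" "m = e i" by (rule e_surj)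
    then show ?thesis using assms by simp
  qed
  then show ?thesis by (simp add: int_lattice_def)
qed

definition centre :: "real ^ 'n" where
  "centre = of_coords (\<lambda>i. of_int (s i) - 1)"

lemma unique_interior_point:
  assumes "interior P \<inter> int_lattice = {p}"
  shows "s 1 = 2" "p = centre"
proof -
  have p: "p \<in> interior P" "p $ e 1 \<in> \<int>"
    using assms by (auto simp: int_lattice_def)
  then obtain z :: int where "p $ e 1 = of_int z" by (auto elim: Ints_cases)
  \<comment> \<open>The integer \<open>z\<close> lies strictly between 0 and
    \<open>s 1\<close>.\<close>
  with interior_first_less[OF p(1)] have s1: "s 1 \<ge> 2" by simp
  have s2: "s i \<ge> 2" if "i \<in> {1..d}" for i using s1 s_first_le[OF that] by simp
  \<comment> \<open>These are the ratios of \<open>centre\<close>, which increase because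
    \<open>s\<close> does.\<close>
  have fr: "1 - 1 / real_of_int (s i) < 1 - 1 / of_int (s (Suc i))" if "i \<in> {1..<d}" for i
    using s_less[OF that] s2[of i] that by (auto simp: field_simps)
  have quot: "(real_of_int (s i) - 1) / of_int (s i) = 1 - 1 / of_int (s i)" if "i \<in> {1..d}" for i
    using s2[OF that] by (simp add: field_simps)
  define q where "q = of_coords (\<lambda>i. if i = 1 then 1 else of_int (s i) - 1)"
  have "centre \<in> interior P"
    unfolding centre_def using s1 fr quot by (intro of_coords_in_interior) auto
  moreover have "q \<in> interior P"
    unfolding q_def
  proof (rule of_coords_in_interior)
    fix i assume i: "i \<in> {1..<d}"
    \<comment> \<open>For \<open>i = 1\<close> this bounds the lowered ratio of \<open>q\<close> by
      that of \<open>centre\<close>; the other ratios are unchanged.\<close>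
    have "1 / real_of_int (s i) \<le> 1 - 1 / of_int (s i)"
      using s2[of i] i by (simp add: field_simps)
    then show "(if i = 1 then 1 else of_int (s i) - 1) / real_of_int (s i)
      < (if Suc i = 1 then 1 else of_int (s (Suc i)) - 1) / of_int (s (Suc i))"
      using fr[OF i] quot[of i] quot[of "Suc i"] i by auto
  qed (use s1 in auto)
  moreover have "centre \<in> int_lattice" "q \<in> int_lattice"
    by (auto simp: centre_def q_def intro!: of_coords_int_lattice)
  ultimately have *: "centre = p" "q = p" using assms by auto
  then show "p = centre" by simp
  have "q $ e 1 = centre $ e 1" using * by simp
  then show "s 1 = 2" using d_pos by (simp add: q_def centre_def)
qed

section \<open>Facet normals of the translated simplex\<close>

text \<open>The scaling makes every right-hand side 1: clearing denominators in the
  \<open>j\<close>-th inequality at \<open>centre + y\<close> leaves \<open>s (Suc j) - s j\<close>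
  on the right.\<close>

definition normal :: "nat \<Rightarrow> real ^ 'n" where
  "normal j = (if j = 0 then - axis (e 1) 1 else if j = d then axis (e d) 1 else
     axis (e j) (of_int (s (Suc j)) / of_int (s (Suc j) - s j))
     - axis (e (Suc j)) (of_int (s j) / of_int (s (Suc j) - s j)))"

lemma normal_inner:
  "normal j \<bullet> y = (if j = 0 then - y $ e 1 else if j = d then y $ e d else
     (of_int (s (Suc j)) * y $ e j - of_int (s j) * y $ e (Suc j)) / of_int (s (Suc j) - s j))"
  by (simp add: normal_def inner_diff_left inner_axis' diff_divide_distrib)

lemma normal_int_lattice:
  assumes "j \<in> {1..<d}"
  shows "normal j \<in> int_lattice \<longleftrightarrow> s (Suc j) - s j dvd s j \<and> s (Suc j) - s j dvd s (Suc j)"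
proof -
  have "normal j \<in> int_lattice \<longleftrightarrow>
    of_int (s (Suc j)) / of_int (s (Suc j) - s j) \<in> (\<int> :: real set) \<and>
    of_int (s j) / of_int (s (Suc j) - s j) \<in> (\<int> :: real set)" (is "_ \<longleftrightarrow> ?a \<in> \<int> \<and> ?b \<in> \<int>")
  proof
    assume "normal j \<in> int_lattice"
    then have "normal j $ e j \<in> \<int>" "normal j $ e (Suc j) \<in> \<int>"
      by (auto simp: int_lattice_def)
    moreover have "normal j $ e j = ?a" "normal j $ e (Suc j) = - ?b"
      \<comment> \<open>The two axis vectors do not overlap, as \<open>e\<close> is
        injective.\<close>
      using assms e_eq_iff[of j "Suc j"] by (auto simp: normal_def axis_def)
    ultimately show "?a \<in> \<int> \<and> ?b \<in> \<int>" by (metis Ints_minus minus_minus)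
  next
    assume "?a \<in> \<int> \<and> ?b \<in> \<int>"
    then show "normal j \<in> int_lattice"
      using assms unfolding int_lattice_def normal_def axis_def
      by (auto simp del: of_int_diff)
  qed
  then show ?thesis
    using s_less[OF assms] by (auto simp: of_int_div_of_int_in_Ints_iff simp del: of_int_diff)
qed

lemma normal_ends_int_lattice: "normal 0 \<in> int_lattice" "normal d \<in> int_lattice"
  using d_pos by (auto simp: int_lattice_def normal_def axis_def)

text \<open>The inequalities correspond one by one; \<open>s 1 = 2\<close> makes the first read
  \<open>- y $ e 1 \<le> 1\<close> instead of having \<open>s 1 - 1\<close> on the right.\<close>

lemma lecture_hall_polytope_eq:
  assumes "s 1 = 2"
  shows "(\<lambda>x. x - centre) ` P = {y. \<forall>a\<in>normal ` {0..d}. a \<bullet> y \<le> 1}"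
proof -
  have "centre + y \<in> P \<longleftrightarrow> (\<forall>j\<in>{0..d}. normal j \<bullet> y \<le> 1)" for y
  proof -
    have c: "centre $ e i = of_int (s i) - 1" if "i \<in> {1..d}" for i
      using that by (simp add: centre_def)
    have "(centre + y) $ e i / of_int (s i) \<le> (centre + y) $ e (i + 1) / of_int (s (i + 1))
      \<longleftrightarrow> normal i \<bullet> y \<le> 1" if "i \<in> {1..<d}" for i
      using that s_pos[of i] s_pos[of "Suc i"] s_less[of i]
      by (simp add: normal_inner c field_simps)
    moreover have "0 \<le> (centre + y) $ e 1 / of_int (s 1) \<longleftrightarrow> normal 0 \<bullet> y \<le> 1"
      using d_pos assms by (auto simp add: normal_inner c)
    moreover have "(centre + y) $ e d / of_int (s d) \<le> 1 \<longleftrightarrow> normal d \<bullet> y \<le> 1"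
      using d_pos s_pos[of d] by (auto simp add: normal_inner c)
    moreover have "{0..d} = insert 0 (insert d {1..<d})" using d_pos by auto
    ultimately show ?thesis by (auto simp: lecture_hall_polytope_def)
  qed
  then show ?thesis by (force simp: image_iff algebra_simps)
qed

section \<open>The dual polytope and its vertices\<close>

text \<open>Weighted by \<open>1 / s j - 1 / s (Suc j)\<close>, the inner normals telescope to a
  combination of the first and last axis vectors, which the end normals cancel. The weights sum to
  \<open>2 / s 1 = 1\<close>.\<close>

lemma zero_in_hull_normals:
  assumes "s 1 = 2"
  shows "0 \<in> convex hull (normal ` {0..d})"
proof -
  define c :: "nat \<Rightarrow> real" where
    "c j = (if j = 0 then 1 / 2 else if j = d then 1 / of_int (s d)
       else 1 / of_int (s j) - 1 / of_int (s (Suc j)))" for j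
  have split: "sum f {0..d} = f 0 + sum f {1..<d} + f d" for f :: "nat \<Rightarrow> real"
  proof -
    have "{0..d} = insert 0 (insert d {1..<d})" using d_pos by auto
    then show ?thesis using d_pos by simp
  qed
  have tele: "(\<Sum>j = 1..<d. g j - g (Suc j)) = g 1 - g d" for g :: "nat \<Rightarrow> real"
    using sum_Suc_diff'[of 1 d "\<lambda>j. - g j"] d_pos by simp
  have "c j \<ge> 0" if "j \<in> {0..d}" for j
    using that s_pos[of j] s_less[of j] by (auto simp: c_def frac_le)
  moreover have "sum c {0..d} = 1"
  proof -
    have "sum c {1..<d} = 1 / of_int (s 1) - 1 / of_int (s d)"
      unfolding tele[of "\<lambda>j. 1 / of_int (s j)", symmetric] by (rule sum.cong) (auto simp: c_def)
    then show ?thesis using d_pos assms unfolding split by (simp add: c_def)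
  qed
  moreover have "(\<Sum>j\<in>{0..d}. c j *\<^sub>R normal j) = 0"
  proof (rule vector_eq_ldot[THEN iffD1], rule allI)
    fix y
    have "c j * (normal j \<bullet> y) = y $ e j / of_int (s j) - y $ e (Suc j) / of_int (s (Suc j))"
      if "j \<in> {1..<d}" for j
      using that s_pos[of j] s_pos[of "Suc j"] s_less[of j]
      by (simp add: c_def normal_inner field_simps)
    then have "(\<Sum>j = 1..<d. c j * (normal j \<bullet> y))
      = (\<Sum>j = 1..<d. y $ e j / of_int (s j) - y $ e (Suc j) / of_int (s (Suc j)))"
      by (intro sum.cong) auto
    also have "\<dots> = y $ e 1 / of_int (s 1) - y $ e d / of_int (s d)"
      by (rule tele)
    finally have "(\<Sum>j\<in>{0..d}. c j * (normal j \<bullet> y)) = 0"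
      using d_pos assms unfolding split by (simp add: c_def normal_inner)
    then show "y \<bullet> (\<Sum>j\<in>{0..d}. c j *\<^sub>R normal j) = y \<bullet> 0"
      by (simp add: inner_sum_right inner_commute)
  qed
  ultimately have "(\<Sum>j\<in>{0..d}. c j *\<^sub>R normal j) \<in> convex hull (normal ` {0..d})"
    by (intro convex_sum) (auto intro: hull_inc)
  then show ?thesis
    by (simp only: \<open>(\<Sum>j\<in>{0..d}. c j *\<^sub>R normal j) = 0\<close>)
qed

text \<open>The vertex opposite a facet gives a functional equal to 1 on all other normals and less
  than 1 on this one, so the normals are convexly independent.\<close>

lemma normal_extreme:
  assumes "s 1 = 2" "i \<in> {0..d}"
  shows "normal i extreme_point_of convex hull (normal ` {0..d})"
proof -
  have "normal i \<notin> convex hull (normal ` {0..d} - {normal i})" if i: "i \<in> {0..d}" for i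
  proof
    assume *: "normal i \<in> convex hull (normal ` {0..d} - {normal i})"
    \<comment> \<open>\<open>w\<close> is the vertex of the simplex opposite to the \<open>i\<close>-th facet.\<close>
    define w where "w = of_coords (\<lambda>j. if j \<le> i then 1 - of_int (s j) else 1)"
    have "normal j \<bullet> w = 1" if "j \<in> {0..d}" "j \<noteq> i" for j
    proof (cases "j \<in> {1..<d}")
      case True
      then show ?thesis using that s_less[OF True] by (auto simp: normal_inner w_def field_simps)
    next
      case False
      with that i d_pos consider "j = 0" "1 \<le> i" | "j = d" "i < d" "0 < d" by fastforce
      then show ?thesis by cases (use d_pos assms(1) in \<open>simp_all add: normal_inner w_def\<close>)
    qed
    then have "w \<bullet> normal j = 1" if "j \<in> {0..d}" "normal j \<noteq> normal i" for j
      using that by (metis inner_commute)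
    then have "normal ` {0..d} - {normal i} \<subseteq> {y. w \<bullet> y = 1}"
      by auto
    then have "convex hull (normal ` {0..d} - {normal i}) \<subseteq> {y. w \<bullet> y = 1}"
      by (rule hull_minimal) (rule convex_hyperplane)
    with * have eq: "normal i \<bullet> w = 1" by (auto simp: inner_commute)
    have "normal i \<bullet> w < 1"
    proof (cases "i \<in> {1..<d}")
      case True
      \<comment> \<open>The inner product is 1 minus this product divided by
        \<open>s (Suc i) - s i\<close>.\<close>
      have "0 < real_of_int (s i) * of_int (s (Suc i))"
        using True s_pos[of i] s_pos[of "Suc i"] by auto
      then show ?thesis using True s_less[OF True]
        by (simp add: normal_inner w_def divide_less_eq algebra_simps)
    next
      case False
      then show ?thesis using i d_pos s_pos[of d] by (auto simp: normal_inner w_def)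
    qed
    with eq show False by simp
  qed
  then show ?thesis
    using assms(2)
    by (subst extreme_point_of_convex_hull_convex_independent) (auto simp: finite_imp_compact)
qed

text \<open>Extreme points of the hull of \<open>V\<close> belong to \<open>V\<close>, so any set of
  lattice points spanning the dual contains all the normals.\<close>

lemma dual_lattice_polytope_iff:
  assumes "s 1 = 2"
  shows "lattice_polytope (dual_polytope ((\<lambda>x. x - centre) ` P)) \<longleftrightarrow>
    normal ` {0..d} \<subseteq> int_lattice"
proof -
  have dual: "dual_polytope ((\<lambda>x. x - centre) ` P) = convex hull (normal ` {0..d})"
    unfolding lecture_hall_polytope_eq[OF assms]
    by (rule dual_polytope_halfspaces) (use zero_in_hull_normals[OF assms] in auto)
  show ?thesis
  proof
    assume "lattice_polytope (dual_polytope ((\<lambda>x. x - centre) ` P))"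
    then obtain V where "V \<subseteq> int_lattice" "convex hull (normal ` {0..d}) = convex hull V"
      by (auto simp: lattice_polytope_def dual)
    then show "normal ` {0..d} \<subseteq> int_lattice"
      using normal_extreme[OF assms] extreme_point_of_convex_hull by fastforce
  next
    assume "normal ` {0..d} \<subseteq> int_lattice"
    then show "lattice_polytope (dual_polytope ((\<lambda>x. x - centre) ` P))"
      unfolding dual lattice_polytope_def by blast
  qed
qed

section \<open>Uniqueness of the Fano translate and the divisibility criterion\<close>

text \<open>Integer translations preserve the lattice and carry interior to interior, so
  \<open>- v\<close> is the only interior lattice point of \<open>P\<close> and must be
  \<open>centre\<close>.\<close>

lemma fano_translate:
  assumes "fano_polytope Q" "translation_equivalent P Q"
  shows "s 1 = 2" "Q = (\<lambda>x. x - centre) ` P"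
proof -
  obtain v where v: "v \<in> int_lattice" "Q = (+) v ` P"
    using assms(2) by (auto simp: translation_equivalent_def)
  have lat: "v + x \<in> int_lattice \<longleftrightarrow> x \<in> int_lattice" for x
  proof -
    have "v $ i + x $ i \<in> \<int> \<longleftrightarrow> x $ i \<in> \<int>" for i
      using v(1) Ints_add Ints_diff[of "v $ i + x $ i" "v $ i"] by (auto simp: int_lattice_def)
    then show ?thesis by (simp add: int_lattice_def)
  qed
  have "(+) v ` interior P \<inter> int_lattice = {0}"
    using assms(1) by (simp add: fano_polytope_def minus_frontier v(2) interior_translation)
  then have *: "v + x \<in> int_lattice \<and> x \<in> interior P \<longleftrightarrow> v + x = 0" for x
  proof -
    have "v + x \<in> (+) v ` interior P \<longleftrightarrow> x \<in> interior P" by auto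
    with \<open>(+) v ` interior P \<inter> int_lattice = {0}\<close> show ?thesis by blast
  qed
  have "interior P \<inter> int_lattice = {- v}"
    using *[unfolded lat] by (intro set_eqI) (simp add: conj_commute add_eq_0_iff)
  note u = unique_interior_point[OF this]
  show "s 1 = 2" by (rule u)
  show "Q = (\<lambda>x. x - centre) ` P" unfolding v(2) u(2)[symmetric] by (simp add: add.commute)
qed

end

theorem theorem2p3:
  fixes d :: nat and e :: "nat \<Rightarrow> 'n::finite" and s k :: "nat \<Rightarrow> int"
  assumes "d \<ge> 1"
    and "bij_betw e {1..d} (UNIV :: 'n set)"
    and "\<forall>i\<in>{1..d}. s i > 0"
    and "strict_mono_on {1..d} s"
    and "\<exists>Q. fano_polytope Q \<and> translation_equivalent (lecture_hall_polytope d e s) Q"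
    and "s 0 = 1"
    and "\<forall>i\<in>{0..d - 1}. k i = s (i + 1) - s i"
  shows "(\<exists>Q. reflexive_polytope Q \<and> translation_equivalent (lecture_hall_polytope d e s) Q)
         \<longleftrightarrow> (\<forall>i\<in>{0..d - 1}. k i dvd s i \<and> k i dvd s (i + 1))"
proof -
  interpret lecture_hall d e s
    using assms by unfold_locales auto
  obtain Q where Q: "fano_polytope Q" "translation_equivalent P Q" using assms(5) by blast
  note s1 = fano_translate(1)[OF Q]
  have "(\<exists>Q. reflexive_polytope Q \<and> translation_equivalent P Q) \<longleftrightarrow>
    lattice_polytope (dual_polytope ((\<lambda>x. x - centre) ` P))"
    \<comment> \<open>All Fano translates coincide, so only one dual has to be tested.\<close>
    unfolding reflexive_polytope_def using Q fano_translate(2) by metis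
  also have "\<dots> \<longleftrightarrow> (\<forall>j\<in>{1..<d}. normal j \<in> int_lattice)"
  proof -
    have "{0..d} = insert 0 (insert d {1..<d})" using d_pos by auto
    then show ?thesis
      using normal_ends_int_lattice by (auto simp: dual_lattice_polytope_iff[OF s1])
  qed
  also have "\<dots> \<longleftrightarrow> (\<forall>i\<in>{1..<d}. k i dvd s i \<and> k i dvd s (i + 1))"
  proof (rule ball_cong[OF refl])
    fix i assume i: "i \<in> {1..<d}"
    then have "k i = s (Suc i) - s i" using assms(7)[rule_format, of i] by force
    then show "normal i \<in> int_lattice \<longleftrightarrow> k i dvd s i \<and> k i dvd s (i + 1)"
      using normal_int_lattice[OF i] by simp
  qed
  also have "\<dots> \<longleftrightarrow> (\<forall>i\<in>{0..d - 1}. k i dvd s i \<and> k i dvd s (i + 1))"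
  proof -
    have "{0..d - 1} = insert 0 {1..<d}" using d_pos by auto
    \<comment> \<open>Index 0 adds only divisibility by \<open>s 1 - s 0 = 2 - 1\<close>.\<close>
    moreover have "k 0 = 1" using assms(6,7) s1 by simp
    ultimately show ?thesis by simp
  qed
  finally show ?thesis .
qed

end
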